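(* Let $n\in\mathbb{N}$, $n\ge 1$, and let $I_1,\dots,I_n$ be independent indicator random variables with success probabilities $p_j=\mathbf{P}(I_j=1)\in[0,1)$, $1\le j\le n$. Let $q_j=1-p_j$, $r_j=p_j/q_j$, $R_l=\sum_{j=l}^n r_j$ for $1\le l\le n$, let $s=\max\{1,\max\{l: R_l\ge 1\}\}$ be the threshold index, and let $V_n=\left(\prod_{j=s}^n q_j\right)\sum_{l=s}^n r_l$ be the success probability under the optimal stopping rule. The following lower bounds hold. 1. If $0\le R_s<1$ and $s=1$, then $$V_n\ge R_1\left(1+\frac{R_1}{n}\right)^{-n},$$ and equality is attained when $p_1=\cdots=p_n=\dfrac{R_1}{n+R_1}$. 2. If $1\le R_s\le 1+\frac{1}{n-s}$ (where for $s=n$ this condition is read as $R_s\ge 1$), then $$V_n\ge\left(1+\frac{1}{n-s+1}\right)^{-(n-s+1)},$$ and equality holds if $p_s=\cdots=p_n=\dfrac{1}{n-s+2}$. 3. If $s<n$ and $R_s>1+\frac{1}{n-s}$, then $$V_n>\left(1+\frac{1}{n-s}\right)^{-(n-s)}.$$ Moreover, for given $1\le s<n$, by choosing the parameter $\alpha\in(0,1)$ sufficiently close to $1$ and setting $$p_s=\frac{1+(2-2\alpha)(n-s)}{1+(3-2\alpha)(n-s)},\qquad p_{s+1}=\cdots=p_n=\frac{\alpha}{n-s+\alpha},$$ the success probability $V_n$ can be made arbitrarily close to $\left(1+\frac{1}{n-s}\right)^{-(n-s)}$.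
   Context: Setting (last-success optimal stopping problem): $I_1,\dots,I_n$ are independent indicator random variables with known success probabilities, observed sequentially. A stopping time is a random variable $t$ with $\{t=k\}\in\sigma(I_1,\dots,I_k)$ for every $1\le k\le n$. One "wins" when stopping at time $t$ if $I_t=1,\ I_{t+1}=0,\dots,I_n=0$, that is, if one stops at the last success. Notation: $p_j=\mathbf{P}(I_j=1)$, $q_j=1-p_j$, odds $r_j=p_j/q_j$, and sums of odds $R_l=\sum_{j=l}^n r_j$ for $1\le l\le n$. The threshold index is $s=\max\{1,\max\{l\in\{1,\dots,n\}: R_l\ge 1\}\}$ with the convention $\max\varnothing=-\infty$ (so $s=1$ if $R_1<1$). The optimal stopping rule $\tau$ (Bruss' odds theorem, known) is to stop at the first index $k\ge s$ with $I_k=1$, if such an index exists. Its winning probability is $$V_n=\mathbf{P}(I_\tau=1,I_{\tau+1}=0,\dots,I_n=0)=\left(\prod_{j=s}^n q_j\right)\sum_{l=s}^n r_l .$$ *)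

theory Defs
  imports "HOL-Probability.Probability"
begin

definition odds :: "(nat \<Rightarrow> real) \<Rightarrow> nat \<Rightarrow> real" where
  "odds p j = p j / (1 - p j)"

definition odds_sum :: "nat \<Rightarrow> (nat \<Rightarrow> real) \<Rightarrow> nat \<Rightarrow> real" where
  "odds_sum n p l = (\<Sum>j=l..n. odds p j)"

(* max {1, max {l. R_l >= 1}}; adjoining 1 to the set implements the convention
   that the maximum of the empty set is -infinity. *)
definition threshold :: "nat \<Rightarrow> (nat \<Rightarrow> real) \<Rightarrow> nat" where
  "threshold n p = Max (insert 1 {l \<in> {1..n}. odds_sum n p l \<ge> 1})"

definition V :: "nat \<Rightarrow> (nat \<Rightarrow> real) \<Rightarrow> real" where
  "V n p = (\<Prod>j=threshold n p..n. 1 - p j) * (\<Sum>l=threshold n p..n. odds p l)"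

(* Stop at the first success with index in {s..n}. If there is none, the rule stops
   at n: this keeps it a stopping time with values in {1..n}, and as I n is then 0 the
   choice never produces a win. *)
definition first_success_from :: "nat \<Rightarrow> nat \<Rightarrow> (nat \<Rightarrow> 'a \<Rightarrow> real) \<Rightarrow> 'a \<Rightarrow> nat" where
  "first_success_from s n I \<omega> =
     (if \<exists>k\<in>{s..n}. I k \<omega> = 1 then LEAST k. k \<in> {s..n} \<and> I k \<omega> = 1 else n)"

definition win_prob :: "'a measure \<Rightarrow> nat \<Rightarrow> (nat \<Rightarrow> 'a \<Rightarrow> real) \<Rightarrow> ('a \<Rightarrow> nat) \<Rightarrow> real" where
  "win_prob M n I t =
     measure M {\<omega> \<in> space M. I (t \<omega>) \<omega> = 1 \<and> (\<forall>j\<in>{t \<omega><..n}. I j \<omega> = 0)}"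

end

theory Submission
  imports Defs
begin

text \<open>
  With \<open>1 - p\<^sub>j = 1 / (1 + r\<^sub>j)\<close> the winning probability is
  \<open>V = R\<^sub>s / (\<Prod>j=s..n. 1 + r\<^sub>j)\<close>, so lower bounds come from AM-GM for the factors
  \<open>1 + r\<^sub>j\<close>. With \<open>m = n - s + 1\<close> factors this gives \<open>V \<ge> R\<^sub>s (1 + R\<^sub>s / m)\<^sup>-\<^sup>m\<close>,
  the first bound; by Bernoulli's inequality its right-hand side is at least its value at
  \<open>R\<^sub>s = 1\<close> as long as \<open>1 \<le> R\<^sub>s \<le> m / (m - 1)\<close>, the second bound. In the third case
  \<open>R\<^sub>s\<^sub>+\<^sub>1 < 1\<close> makes \<open>R\<^sub>s / (1 + r\<^sub>s)\<close> strictly increasing in \<open>r\<^sub>s\<close> for fixed later odds,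
  so \<open>R\<^sub>s\<close> may be lowered to \<open>1 + 1 / (n - s)\<close> before applying AM-GM.
\<close>

section \<open>AM-GM in power form, and elementary facts about odds\<close>

lemma prod_le_mean_power:
  fixes x :: "'a \<Rightarrow> real"
  assumes S: "finite S" "S \<noteq> {}" and x: "\<And>i. i \<in> S \<Longrightarrow> x i \<ge> 0"
  shows "prod x S \<le> (sum x S / card S) ^ card S"
proof -
  have c: "card S > 0" using S by (simp add: card_gt_0_iff)
  have P: "0 \<le> prod x S" using x by (simp add: prod_nonneg)
  \<comment> \<open>\<open>0 powr a = 0\<close>, so a vanishing product also equals the power of its
    root, because \<open>card S > 0\<close>.\<close>
  have "prod x S = (prod x S powr (1 / card S)) ^ card S"
    using c P by (cases "prod x S = 0") (simp_all add: powr_power)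
  also have "\<dots> \<le> (\<Sum>i\<in>S. x i / card S) ^ card S"
    by (intro power_mono arith_geom_mean S x) auto
  finally show ?thesis by (simp add: sum_divide_distrib)
qed

lemma one_minus_eq_inverse_odds:
  assumes "p j < 1"
  shows "1 - p j = inverse (1 + odds p j)"
  using assms by (simp add: odds_def field_simps)

lemma odds_nonneg: "p j \<in> {0..<1} \<Longrightarrow> 0 \<le> odds p j"
  by (simp add: odds_def)

text \<open>The constant probabilities of both equality cases and the tail of the asymptotically
  sharp family have the form \<open>a / (b + a)\<close>, so their odds can be read off.\<close>

lemma odds_eq:
  assumes "p j = a / (b + a)" "b \<noteq> 0" "b + a \<noteq> 0"
  shows "odds p j = a / b"
proof -
  have "1 - a / (b + a) = b / (b + a)" using assms by (simp add: field_simps)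
  then show ?thesis using assms by (simp add: odds_def)
qed

lemma odds_sum_const:
  assumes "\<forall>j\<in>{s..n}. p j = a / (b + a)" "b \<noteq> 0" "b + a \<noteq> 0" "s \<le> n"
  shows "odds_sum n p s = real (n - s + 1) * (a / b)"
proof -
  have "odds_sum n p s = (\<Sum>j=s..n. a / b)"
    unfolding odds_sum_def using assms by (intro sum.cong odds_eq) auto
  then show ?thesis using assms by (simp add: Suc_diff_le)
qed

lemma odds_sum_Suc:
  assumes "s \<le> n"
  shows "odds_sum n p s = odds p s + odds_sum n p (Suc s)"
  using assms by (simp add: odds_sum_def sum.atLeast_Suc_atMost)

lemma odds_sum_nonneg:
  assumes "\<forall>j\<in>{s..n}. p j \<in> {0..<1}"
  shows "0 \<le> odds_sum n p s"
  unfolding odds_sum_def using assms by (intro sum_nonneg odds_nonneg) auto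

lemma odds_sum_antimono:
  assumes "\<forall>j\<in>{s..n}. p j \<in> {0..<1}" "s \<le> l"
  shows "odds_sum n p l \<le> odds_sum n p s"
  unfolding odds_sum_def using assms by (intro sum_mono2 odds_nonneg) auto

section \<open>The threshold index\<close>

lemma threshold_range:
  assumes "n \<ge> 1"
  shows "threshold n p \<in> {1..n}"
proof -
  have "threshold n p \<in> insert 1 {l \<in> {1..n}. odds_sum n p l \<ge> 1}"
    unfolding threshold_def by (intro Max_in) auto
  then show ?thesis using assms by auto
qed

lemma odds_sum_beyond_threshold:
  assumes "threshold n p < l" "l \<le> n"
  shows "odds_sum n p l < 1"
proof (rule ccontr)
  assume "\<not> odds_sum n p l < 1"
  then have "l \<le> threshold n p"
    unfolding threshold_def using assms by (intro Max_ge) auto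
  then show False using assms by simp
qed

text \<open>Sums of odds decrease in the starting index, so a value below 1 at \<open>Suc s\<close>
  rules out every larger candidate. For \<open>s = n\<close> that sum is empty.\<close>

lemma threshold_eqI:
  assumes s: "s \<in> {1..n}" "s = 1 \<or> odds_sum n p s \<ge> 1"
    and p: "\<forall>j\<in>{Suc s..n}. p j \<in> {0..<1}" and R: "odds_sum n p (Suc s) < 1"
  shows "threshold n p = s"
  unfolding threshold_def
proof (rule Max_eqI)
  fix l assume l: "l \<in> insert 1 {l \<in> {1..n}. odds_sum n p l \<ge> 1}"
  have "l \<le> s" if "odds_sum n p l \<ge> 1"
    using odds_sum_antimono[OF p, of l] R that by (meson not_less_eq_eq leD order_trans)
  then show "l \<le> s" using l s by auto
qed (use s in auto)

section \<open>The winning probability in terms of odds, and its lower bounds\<close>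

lemma V_eq_odds:
  assumes "\<forall>j\<in>{threshold n p..n}. p j < 1"
  shows "V n p = odds_sum n p (threshold n p) / (\<Prod>j=threshold n p..n. 1 + odds p j)"
proof -
  have "(\<Prod>j=threshold n p..n. 1 - p j) = (\<Prod>j=threshold n p..n. inverse (1 + odds p j))"
    using assms by (intro prod.cong one_minus_eq_inverse_odds) auto
  then show ?thesis
    by (simp add: V_def odds_sum_def prod_inversef[symmetric] o_def divide_inverse mult.commute)
qed

text \<open>The equality case of AM-GM: all factors \<open>1 + odds p j\<close> coincide with their
  mean, so the bound of \<open>V_ge_mean\<close> is attained.\<close>

lemma V_const:
  assumes "threshold n p = s" "\<forall>j\<in>{s..n}. p j = a / (b + a)" "b > 0" "a \<ge> 0" "s \<le> n"
  shows "V n p = odds_sum n p s * (1 + a / b) powi (- int (n - s + 1))"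
proof -
  have "(\<Prod>j=s..n. 1 - p j) = (\<Prod>j=s..n. inverse (1 + a / b))"
    using assms by (intro prod.cong) (auto simp: field_simps)
  then show ?thesis
    using assms by (simp add: V_def odds_sum_def power_int_minus power_inverse Suc_diff_le del: of_nat_Suc)
qed

text \<open>Gives the first bound directly, with \<open>m = n\<close>, and the second after
  comparison with the value at \<open>R = 1\<close>.\<close>

lemma V_ge_mean:
  assumes n: "n \<ge> 1" and p: "\<forall>j\<in>{1..n}. p j \<in> {0..<1}" and m: "m = n - threshold n p + 1"
  defines "R \<equiv> odds_sum n p (threshold n p)"
  shows "V n p \<ge> R / (1 + R / m) ^ m"
proof -
  let ?S = "{threshold n p..n}"
  have s: "threshold n p \<in> {1..n}" by (rule threshold_range[OF n])
  have p': "\<forall>j\<in>?S. p j \<in> {0..<1}" using p s by auto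
  have c: "card ?S = m" using s m by (simp add: Suc_diff_le)
  have R0: "0 \<le> R" unfolding R_def by (rule odds_sum_nonneg[OF p'])
  have "(\<Prod>j\<in>?S. 1 + odds p j) \<le> ((\<Sum>j\<in>?S. 1 + odds p j) / card ?S) ^ card ?S"
    using s p' by (intro prod_le_mean_power) (auto intro!: add_nonneg_nonneg odds_nonneg)
  also have "(\<Sum>j\<in>?S. 1 + odds p j) / card ?S = 1 + R / m"
    using c m unfolding R_def odds_sum_def sum.distrib by (simp add: add_divide_distrib)
  finally have "(\<Prod>j\<in>?S. 1 + odds p j) \<le> (1 + R / m) ^ m" unfolding c .
  moreover have "0 < (\<Prod>j\<in>?S. 1 + odds p j)"
    using p' by (intro prod_pos) (auto intro!: add_pos_nonneg odds_nonneg)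
  ultimately have "R / (1 + R / m) ^ m \<le> R / (\<Prod>j\<in>?S. 1 + odds p j)"
    using R0 by (intro divide_left_mono) auto
  also have "\<dots> = V n p" unfolding R_def using p' by (intro V_eq_odds[symmetric]) auto
  finally show ?thesis .
qed

text \<open>The quotient of the two bases is \<open>1 - (R - 1) / (m + R)\<close>, and Bernoulli
  bounds its \<open>m\<close>-th power from below by a linear expression. The upper bound on
  \<open>R\<close> is cleared of its denominator so that \<open>m = 1\<close>, that is
  \<open>s = n\<close>, is covered.\<close>

lemma mean_bound_mono:
  fixes R :: real
  assumes m: "m \<ge> 1" and R: "1 \<le> R" "(real m - 1) * R \<le> m"
  shows "1 / (1 + 1 / m) ^ m \<le> R / (1 + R / m) ^ m"
proof -
  have pos: "real m + R > 0" using R m by simp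
  have "0 \<le> (R - 1) * (m - (real m - 1) * R)" using R by simp
  \<comment> \<open>Multiplying out \<open>m + R\<close> turns this inequality into the
    nonnegativity of the product just shown.\<close>
  then have "1 \<le> R * (1 + real m * (- ((R - 1) / (m + R))))"
    using pos by (simp add: field_simps power2_eq_square)
  also have "\<dots> \<le> R * (1 + - ((R - 1) / (m + R))) ^ m"
  proof (intro mult_left_mono Bernoulli_inequality)
    show "-1 \<le> - ((R - 1) / (m + R))" using pos m by (simp add: field_simps)
  qed (use R in auto)
  also have "1 + - ((R - 1) / (m + R)) = ((m + 1) / m) / ((m + R) / m)"
    using pos m by (simp add: diff_divide_eq_iff)
  also have "\<dots> = (1 + 1 / m) / (1 + R / m)"
    using m by (simp add: add_divide_distrib)
  finally have "1 \<le> R * ((1 + 1 / m) ^ m / (1 + R / m) ^ m)"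
    by (simp add: power_divide)
  moreover have "0 < (1 + 1 / real m) ^ m" by (simp add: add_pos_nonneg)
  ultimately show ?thesis by (simp add: pos_divide_le_eq mult.commute)
qed

text \<open>AM-GM is applied with the factor \<open>1 + r\<^sub>s\<close> replaced by its infimum
  \<open>1 + (1 + 1/k) - R\<^sub>s\<^sub>+\<^sub>1\<close>: the mean of the \<open>k + 1\<close> factors is then exactly
  \<open>1 + 1/k\<close>.\<close>
lemma V_gt_large_odds:
  assumes n: "n \<ge> 1" and p: "\<forall>j\<in>{1..n}. p j \<in> {0..<1}"
    and s: "threshold n p < n" and k: "k = n - threshold n p"
    and R: "odds_sum n p (threshold n p) > 1 + 1 / k"
  shows "V n p > 1 / (1 + 1 / k) ^ k"
proof -
  define s where "s = threshold n p"
  define T where "T = odds_sum n p (Suc s)"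
  define P where "P = (\<Prod>j=Suc s..n. 1 + odds p j)"
  define c where "c = 1 + 1 / real k"
  define R where "R = odds_sum n p s"
  have s1: "s \<in> {1..n}" "s < n" using threshold_range[OF n] s unfolding s_def by auto
  have k1: "k \<ge> 1" "k = n - s" using k s by (auto simp: s_def)
  have c1: "c > 1" using k1 by (simp add: c_def)
  have T1: "T < 1" unfolding T_def by (intro odds_sum_beyond_threshold) (use s1 s_def in auto)
  have RT: "odds p s = R - T" using odds_sum_Suc[of s n p] s1 by (simp add: R_def T_def)
  have cR: "c < R" using assms(5) by (simp add: c_def R_def s_def)
  have P0: "P > 0"
    unfolding P_def using p s1 by (intro prod_pos) (auto intro!: add_pos_nonneg odds_nonneg)
  define x where "x j = (if j = s then 1 + c - T else 1 + odds p j)" for j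
  have "prod x {s..n} \<le> (sum x {s..n} / card {s..n}) ^ card {s..n}"
    using s1 p T1 c1
    by (intro prod_le_mean_power) (auto simp: x_def intro!: add_nonneg_nonneg odds_nonneg)
  moreover have "prod x {s..n} = (1 + c - T) * P"
    using s1 unfolding P_def
    by (subst prod.atLeast_Suc_atMost) (auto simp: x_def intro!: prod.cong)
  moreover have "sum x {s..n} = (1 + c - T) + (k + T)"
  proof -
    have "sum x {Suc s..n} = (\<Sum>j=Suc s..n. 1 + odds p j)"
      by (intro sum.cong) (auto simp: x_def)
    also have "\<dots> = k + T"
      using k1 s1 unfolding sum.distrib T_def odds_sum_def by simp
    finally show ?thesis
      using s1 by (subst sum.atLeast_Suc_atMost) (auto simp: x_def)
  qed
  moreover have "card {s..n} = Suc k" using k1 s1 by simp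
  moreover have "((1 + c - T) + (k + T)) / real (Suc k) = c"
  proof -
    have "(1 + c - T) + (k + T) = c * Suc k" using k1(1) by (simp add: c_def field_simps)
    then show ?thesis by simp
  qed
  ultimately have AG: "(1 + c - T) * P \<le> c ^ Suc k" by simp
  \<comment> \<open>Expanding by \<open>c\<close> produces the exponent \<open>Suc k\<close> that
    AM-GM over \<open>k + 1\<close> factors controls.\<close>
  have "1 / c ^ k = c / c ^ Suc k" using c1 by simp
  also have "\<dots> \<le> c / ((1 + c - T) * P)"
    using AG c1 T1 P0 by (intro divide_left_mono) auto
  also have "\<dots> < R / ((1 + (R - T)) * P)"
  proof -
    \<comment> \<open>This product is the difference of the cross-multiplied fractions. Strictness
      comes from \<open>c < R\<close> together with \<open>T < 1\<close>.\<close>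
    have "0 < (R - c) * (1 - T)" using cR T1 by simp
    then have "c * (1 + (R - T)) < R * (1 + c - T)" by (simp add: algebra_simps)
    then have "c / (1 + c - T) < R / (1 + (R - T))"
      using cR T1 c1 by (simp add: divide_simps)
    from divide_strict_right_mono[OF this P0] show ?thesis by simp
  qed
  also have "(1 + (R - T)) * P = (\<Prod>j=s..n. 1 + odds p j)"
    using s1 RT unfolding P_def by (subst prod.atLeast_Suc_atMost) auto
  also have "R / \<dots> = V n p"
    unfolding R_def s_def using p s1 by (intro V_eq_odds[symmetric]) (auto simp: s_def)
  finally show ?thesis by (simp add: c_def)
qed

section \<open>The asymptotically sharp family for large sums of odds\<close>

text \<open>The tail odds sum to \<alpha>, below 1, which fixes the threshold at \<open>s\<close>,
  while the sum from \<open>s\<close> exceeds \<open>1 + 1 / k\<close> by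
  \<open>1 - \<alpha>\<close>. As \<alpha> tends to 1 all odds tend to \<open>1 / k\<close>, so
  AM-GM becomes tight in the limit.\<close>

lemma large_odds_family:
  assumes s: "s \<in> {1..<n}" and k: "k = n - s" and \<alpha>: "0 < \<alpha>" "\<alpha> < 1"
    and ps: "p s = (1 + (2 - 2 * \<alpha>) * real k) / (1 + (3 - 2 * \<alpha>) * real k)"
    and p: "\<forall>j\<in>{Suc s..n}. p j = \<alpha> / (real k + \<alpha>)"
  shows "p s \<in> {0..<1}" "threshold n p = s" "odds_sum n p s = 1 + 1 / k + (1 - \<alpha>)"
    "V n p = (1 + 1 / k + (1 - \<alpha>)) / ((1 + 1 / k + (2 - 2 * \<alpha>)) * (1 + \<alpha> / k) ^ k)"
proof -
  have k1: "real k \<ge> 1" "k \<ge> 1" using s k by auto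
  have "0 \<le> (2 - 2 * \<alpha>) * real k" using \<alpha> by simp
  then have num: "0 \<le> 1 + (2 - 2 * \<alpha>) * real k" by simp
  \<comment> \<open>The denominator is the numerator plus \<open>k\<close>, so the odds at
    \<open>s\<close> are the numerator divided by \<open>k\<close>.\<close>
  have den: "1 + (3 - 2 * \<alpha>) * real k = (1 + (2 - 2 * \<alpha>) * real k) + real k"
    by (simp add: algebra_simps)
  show p_s: "p s \<in> {0..<1}" using num k1 unfolding ps den by (simp add: field_simps)
  have "odds p s = (1 + (2 - 2 * \<alpha>) * real k) / k"
    using num k1 unfolding odds_def ps den by (simp add: divide_simps)
  then have os: "odds p s = 1 / k + (2 - 2 * \<alpha>)" using k1 by (simp add: add_divide_distrib)
  have p01: "\<forall>j\<in>{Suc s..n}. p j \<in> {0..<1}" using p \<alpha> k1 by simp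
  have T: "odds_sum n p (Suc s) = \<alpha>"
    using odds_sum_const[OF p] k1 \<alpha> s k by (simp add: Suc_diff_Suc)
  then show R: "odds_sum n p s = 1 + 1 / k + (1 - \<alpha>)"
    using s os by (subst odds_sum_Suc) auto
  show th: "threshold n p = s"
  proof (rule threshold_eqI)
    have "0 \<le> 1 / real k" by simp
    then have "1 \<le> odds_sum n p s" unfolding R using \<alpha> by linarith
    then show "s = 1 \<or> odds_sum n p s \<ge> 1" by simp
  qed (use s T \<alpha> p01 in auto)
  have oj: "odds p j = \<alpha> / k" if "j \<in> {Suc s..n}" for j
    using p that \<alpha> k1 by (intro odds_eq) auto
  have "(\<Prod>j=s..n. 1 + odds p j) = (1 + odds p s) * (\<Prod>j=Suc s..n. 1 + odds p j)"
    using s by (subst prod.atLeast_Suc_atMost) auto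
  also have "(\<Prod>j=Suc s..n. 1 + odds p j) = (\<Prod>j=Suc s..n. 1 + \<alpha> / k)"
    using oj by (intro prod.cong) auto
  also have "\<dots> = (1 + \<alpha> / k) ^ k" using k s by simp
  finally have prod: "(\<Prod>j=s..n. 1 + odds p j) = (1 + 1 / k + (2 - 2 * \<alpha>)) * (1 + \<alpha> / k) ^ k"
    using os by simp
  have "\<forall>j\<in>{s..n}. p j < 1" using p_s p01 by (auto simp: le_eq_less_or_eq Suc_le_eq)
  then show "V n p = (1 + 1 / k + (1 - \<alpha>)) / ((1 + 1 / k + (2 - 2 * \<alpha>)) * (1 + \<alpha> / k) ^ k)"
    using V_eq_odds[of n p] unfolding th prod R by simp
qed

text \<open>The closed form is continuous at 1, where the factor \<open>1 + 1 / k\<close> cancels.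
  The limit is one-sided because the family lives on \<alpha> below 1.\<close>

lemma large_odds_family_limit:
  assumes k: "k \<ge> 1"
  shows "((\<lambda>\<alpha>. (1 + 1 / real k + (1 - \<alpha>)) / ((1 + 1 / k + (2 - 2 * \<alpha>)) * (1 + \<alpha> / k) ^ k))
    \<longlongrightarrow> 1 / (1 + 1 / k) ^ k) (at_left 1)"
proof -
  have c: "1 + 1 / real k > 0" by (simp add: add_pos_nonneg)
  have "((\<lambda>\<alpha>. (1 + 1 / real k + (1 - \<alpha>)) / ((1 + 1 / k + (2 - 2 * \<alpha>)) * (1 + \<alpha> / k) ^ k))
    \<longlongrightarrow> (1 + 1 / real k + (1 - 1)) / ((1 + 1 / k + (2 - 2 * 1)) * (1 + 1 / k) ^ k)) (at_left 1)"
    using c k by (intro tendsto_intros) auto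
  also have "(1 + 1 / real k + (1 - 1)) / ((1 + 1 / k + (2 - 2 * 1)) * (1 + 1 / k) ^ k)
    = 1 / (1 + 1 / k) ^ k"
    using c by simp
  finally show ?thesis .
qed

section \<open>The winning probability of the odds rule\<close>

lemma first_success_from_eq:
  assumes "k \<in> {s..n}" "I k \<omega> = 1" "\<forall>j\<in>{s..<k}. I j \<omega> \<noteq> 1"
  shows "first_success_from s n I \<omega> = k"
proof -
  have "(LEAST j. j \<in> {s..n} \<and> I j \<omega> = 1) = k"
    using assms by (intro Least_equality) (auto simp: not_less[symmetric])
  moreover have "\<exists>k\<in>{s..n}. I k \<omega> = 1" using assms by blast
  ultimately show ?thesis unfolding first_success_from_def by (simp only: if_True)
qed

text \<open>A first success that is also the last is the only one. This replaces the event involving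
  a random index by conditions on fixed indices.\<close>

lemma win_iff_unique_success:
  assumes s: "s \<le> n" and I: "\<forall>j\<in>{s..n}. I j \<omega> \<in> {0, 1}"
  defines "t \<equiv> first_success_from s n I \<omega>"
  shows "I t \<omega> = 1 \<and> (\<forall>j\<in>{t<..n}. I j \<omega> = 0) \<longleftrightarrow>
    (\<exists>l\<in>{s..n}. \<forall>j\<in>{s..n}. I j \<omega> = (if j = l then 1 else 0))"
    (is "?L \<longleftrightarrow> ?R")
proof
  assume L: ?L
  show ?R
  proof (cases "\<exists>k\<in>{s..n}. I k \<omega> = 1")
    case True
    define k where "k = (LEAST k. k \<in> {s..n} \<and> I k \<omega> = 1)"
    have k: "k \<in> {s..n} \<and> I k \<omega> = 1" unfolding k_def by (rule LeastI_ex) (use True in auto)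
    have "k \<le> j" if "j \<in> {s..n} \<and> I j \<omega> = 1" for j
      unfolding k_def by (rule Least_le) (rule that)
    then have lt: "\<forall>j\<in>{s..<k}. I j \<omega> \<noteq> 1" using k by fastforce
    then have tk: "t = k" unfolding t_def using k by (intro first_success_from_eq) auto
    show ?R
    proof (rule bexI[of _ k], rule ballI)
      fix j assume j: "j \<in> {s..n}"
      show "I j \<omega> = (if j = k then 1 else 0)"
      proof (cases j k rule: linorder_cases)
        case less
        then have "I j \<omega> \<noteq> 1" using lt j by simp
        then show ?thesis using I j less by force
      next
        case greater
        then show ?thesis using L j unfolding tk by simp
      qed (use k in simp)
    qed (use k in auto)
  next
    case False
    \<comment> \<open>The default stopping index is \<open>n\<close>; a win there would need a
      success at \<open>n\<close>, contradicting the case.\<close>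
    then have "t = n" unfolding t_def first_success_from_def by (simp only: if_False)
    then have "I n \<omega> = 1" using L by simp
    then show ?R using False s by auto
  qed
next
  assume ?R
  then obtain l where l: "l \<in> {s..n}" "\<forall>j\<in>{s..n}. I j \<omega> = (if j = l then 1 else 0)" by blast
  have "t = l" unfolding t_def by (rule first_success_from_eq) (use l in auto)
  then show ?L using l by auto
qed

text \<open>The win splits into disjoint events according to the position \<open>l\<close> of the
  only success. By independence each has the product of all failure probabilities with the factor at
  \<open>l\<close> replaced by \<open>p l\<close>, which amounts to multiplication by
  \<open>odds p l\<close>.\<close>

lemma (in prob_space) win_prob_first_success_from:
  assumes s: "s \<in> {1..n}"
    and indep: "indep_vars (\<lambda>_. borel) I {1..n}"
    and I: "\<forall>j\<in>{1..n}. \<forall>\<omega>\<in>space M. I j \<omega> \<in> {0, 1::real}"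
    and p: "\<forall>j\<in>{1..n}. p j = prob {\<omega> \<in> space M. I j \<omega> = 1}"
    and p1: "\<forall>j\<in>{1..n}. p j < 1"
  shows "win_prob M n I (first_success_from s n I)
    = (\<Prod>j=s..n. 1 - p j) * (\<Sum>l=s..n. odds p l)"
proof -
  \<comment> \<open>Written as an intersection of preimages so that \<open>indep_varsD\<close>
    applies.\<close>
  define E where "E l = (\<Inter>j\<in>{s..n}. I j -` (if j = l then {1} else {0}) \<inter> space M)" for l
  have rv: "random_variable borel (I j)" if "j \<in> {1..n}" for j
    using indep that by (auto simp: indep_vars_def)
  have E_ev: "E l \<in> events" for l
    unfolding E_def using s by (intro sets.finite_INT measurable_sets[OF rv]) auto
  have E_iff: "\<omega> \<in> E l \<longleftrightarrow> \<omega> \<in> space M \<and> (\<forall>j\<in>{s..n}. I j \<omega> = (if j = l then 1 else 0))" for \<omega> l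
    unfolding E_def using s by (auto split: if_splits)
  have disj: "disjoint_family_on E {s..n}"
    unfolding disjoint_family_on_def
  proof (intro ballI impI)
    fix l m assume lm: "l \<in> {s..n}" "m \<in> {s..n}" "l \<noteq> m"
    have False if "\<omega> \<in> E l" "\<omega> \<in> E m" for \<omega>
    proof -
      have "I l \<omega> = 1" using that(1) lm unfolding E_iff by auto
      moreover have "I l \<omega> = 0" using that(2) lm unfolding E_iff by auto
      ultimately show False by simp
    qed
    then show "E l \<inter> E m = {}" by blast
  qed
  have pr1: "prob (I j -` {1} \<inter> space M) = p j" if "j \<in> {s..n}" for j
    using p that s by (auto intro!: arg_cong[where f=prob])
  have pr0: "prob (I j -` {0} \<inter> space M) = 1 - p j" if "j \<in> {s..n}" for j
  proof -
    have j: "j \<in> {1..n}" using that s by auto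
    have "\<forall>\<omega>\<in>space M. I j \<omega> \<in> {0, 1}" using I j by blast
    then have "I j -` {0} \<inter> space M = space M - (I j -` {1} \<inter> space M)" by auto
    then show ?thesis
      using prob_compl[of "I j -` {1} \<inter> space M"] rv[OF j] pr1[OF that]
      by (auto intro: measurable_sets)
  qed
  have prE: "prob (E l) = (\<Prod>j=s..n. 1 - p j) * odds p l" if l: "l \<in> {s..n}" for l
  proof -
    have "prob (E l) = (\<Prod>j=s..n. prob (I j -` (if j = l then {1} else {0}) \<inter> space M))"
      unfolding E_def by (rule indep_varsD[OF indep]) (use s in auto)
    also have "\<dots> = (\<Prod>j=s..n. if j = l then p j else 1 - p j)"
      using pr0 pr1 by (intro prod.cong) auto
    also have "\<dots> = p l * (\<Prod>j\<in>{s..n} - {l}. if j = l then p j else 1 - p j)"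
      using l by (subst prod.remove[of _ l]) auto
    also have "(\<Prod>j\<in>{s..n} - {l}. if j = l then p j else 1 - p j) = (\<Prod>j\<in>{s..n} - {l}. 1 - p j)"
      by (intro prod.cong) auto
    \<comment> \<open>Expanding by \<open>1 - p l\<close>, which is nonzero, restores the missing
      factor of the product.\<close>
    also have "p l * \<dots> = ((1 - p l) * (\<Prod>j\<in>{s..n} - {l}. 1 - p j)) * odds p l"
    proof -
      have "p l < 1" using p1 l s by auto
      then show ?thesis by (simp add: odds_def)
    qed
    also have "(1 - p l) * (\<Prod>j\<in>{s..n} - {l}. 1 - p j) = (\<Prod>j=s..n. 1 - p j)"
      using l by (subst prod.remove[of _ l, symmetric]) auto
    finally show ?thesis .
  qed
  have "{\<omega> \<in> space M. I (first_success_from s n I \<omega>) \<omega> = 1 \<and>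
      (\<forall>j\<in>{first_success_from s n I \<omega><..n}. I j \<omega> = 0)} = (\<Union>l\<in>{s..n}. E l)"
  proof (rule set_eqI)
    fix \<omega>
    show "\<omega> \<in> {\<omega> \<in> space M. I (first_success_from s n I \<omega>) \<omega> = 1 \<and>
      (\<forall>j\<in>{first_success_from s n I \<omega><..n}. I j \<omega> = 0)} \<longleftrightarrow> \<omega> \<in> (\<Union>l\<in>{s..n}. E l)"
    proof (cases "\<omega> \<in> space M")
      case True
      then have "\<forall>j\<in>{s..n}. I j \<omega> \<in> {0, 1}" using I s by simp
      with True show ?thesis
        using win_iff_unique_success[of s n I \<omega>] s by (simp add: E_iff)
    qed (simp add: E_iff)
  qed
  then have "win_prob M n I (first_success_from s n I) = prob (\<Union>l\<in>{s..n}. E l)"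
    by (simp add: win_prob_def)
  also have "\<dots> = (\<Sum>l=s..n. prob (E l))"
    using disj E_ev by (intro finite_measure_finite_Union) auto
  also have "\<dots> = (\<Sum>l=s..n. (\<Prod>j=s..n. 1 - p j) * odds p l)"
    using prE by (intro sum.cong) auto
  finally show ?thesis by (simp add: sum_distrib_left)
qed

section \<open>The value of the odds rule, the three bounds and their sharpness\<close>

theorem theorem3:
  fixes M :: "'a measure" and I :: "nat \<Rightarrow> 'a \<Rightarrow> real" and n :: nat and p :: "nat \<Rightarrow> real"
  assumes n: "n \<ge> 1"
    and M: "prob_space M"
    and indep: "prob_space.indep_vars M (\<lambda>_. borel) I {1..n}"
    and indicators: "\<forall>j\<in>{1..n}. \<forall>\<omega>\<in>space M. I j \<omega> \<in> {0, 1}"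
    and p: "\<forall>j\<in>{1..n}. p j = measure M {\<omega> \<in> space M. I j \<omega> = 1}"
    and p_range: "\<forall>j\<in>{1..n}. p j \<in> {0..<1}"
  shows
    \<comment> \<open>the success probability of the odds rule\<close>
    "win_prob M n I (first_success_from (threshold n p) n I) = V n p \<and>
    \<comment> \<open>1: bound and attainment, for every value of the total odds\<close>
    (0 \<le> odds_sum n p (threshold n p) \<and> odds_sum n p (threshold n p) < 1 \<and> threshold n p = 1
       \<longrightarrow> V n p \<ge> odds_sum n p 1 * (1 + odds_sum n p 1 / real n) powi (- int n)) \<and>
    (\<forall>\<rho>\<in>{0..<1}. \<forall>p'. (\<forall>j\<in>{1..n}. p' j = \<rho> / (real n + \<rho>))
       \<longrightarrow> threshold n p' = 1 \<and> odds_sum n p' 1 = \<rho> \<and>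
           V n p' = \<rho> * (1 + \<rho> / real n) powi (- int n)) \<and>
    \<comment> \<open>2: bound and attainment, for every threshold index\<close>
    (1 \<le> odds_sum n p (threshold n p) \<and>
     (threshold n p < n
        \<longrightarrow> odds_sum n p (threshold n p) \<le> 1 + 1 / real (n - threshold n p))
       \<longrightarrow> V n p \<ge> (1 + 1 / real (n - threshold n p + 1)) powi (- int (n - threshold n p + 1))) \<and>
    (\<forall>s\<in>{1..n}. \<forall>p'. (\<forall>j\<in>{1..n}. p' j \<in> {0..<1}) \<and> (\<forall>j\<in>{s..n}. p' j = 1 / real (n - s + 2))
       \<longrightarrow> threshold n p' = s \<and> 1 \<le> odds_sum n p' s \<and>
           (s < n \<longrightarrow> odds_sum n p' s \<le> 1 + 1 / real (n - s)) \<and>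
           V n p' = (1 + 1 / real (n - s + 1)) powi (- int (n - s + 1))) \<and>
    \<comment> \<open>3: strict bound and asymptotic sharpness, for every threshold index below n\<close>
    (threshold n p < n \<and>
     odds_sum n p (threshold n p) > 1 + 1 / real (n - threshold n p)
       \<longrightarrow> V n p > (1 + 1 / real (n - threshold n p)) powi (- int (n - threshold n p))) \<and>
    (\<forall>s\<in>{1..<n}. \<forall>\<epsilon>>0. \<exists>\<delta>\<in>{0<..<1}. \<forall>\<alpha>\<in>{\<delta><..<1}. \<forall>p'.
       (\<forall>j\<in>{1..n}. j \<noteq> s \<longrightarrow> p' j \<in> {0..<1}) \<and>
       p' s = (1 + (2 - 2 * \<alpha>) * real (n - s)) / (1 + (3 - 2 * \<alpha>) * real (n - s)) \<and>
       (\<forall>j\<in>{s+1..n}. p' j = \<alpha> / (real (n - s) + \<alpha>))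
       \<longrightarrow> p' s \<in> {0..<1} \<and> threshold n p' = s \<and> odds_sum n p' s > 1 + 1 / real (n - s) \<and>
           \<bar>V n p' - (1 + 1 / real (n - s)) powi (- int (n - s))\<bar> < \<epsilon>)"
proof (intro conjI impI ballI allI)
  have s: "threshold n p \<in> {1..n}" by (rule threshold_range[OF n])
  show "win_prob M n I (first_success_from (threshold n p) n I) = V n p"
    unfolding V_def
    by (rule prob_space.win_prob_first_success_from[OF M s indep indicators p]) (use p_range in auto)
  show "V n p \<ge> odds_sum n p 1 * (1 + odds_sum n p 1 / real n) powi (- int n)"
    if "0 \<le> odds_sum n p (threshold n p) \<and> odds_sum n p (threshold n p) < 1 \<and> threshold n p = 1"
    using V_ge_mean[OF n p_range refl] that n by (simp add: power_int_minus divide_inverse)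
  show "V n p \<ge> (1 + 1 / real (n - threshold n p + 1)) powi (- int (n - threshold n p + 1))"
    if h: "1 \<le> odds_sum n p (threshold n p) \<and> (threshold n p < n
        \<longrightarrow> odds_sum n p (threshold n p) \<le> 1 + 1 / real (n - threshold n p))"
  proof -
    define m where "m = n - threshold n p + 1"
    define R where "R = odds_sum n p (threshold n p)"
    \<comment> \<open>Below \<open>n\<close>, \<open>real m - 1\<close> is the denominator in the
      hypothesis; at \<open>n\<close> it is 0 and the left side vanishes.\<close>
    have "(real m - 1) * R \<le> m"
    proof (cases "threshold n p < n")
      case True
      then have "R \<le> 1 + 1 / (real m - 1)" "real m - 1 > 0" using h by (auto simp: m_def R_def)
      then show ?thesis by (simp add: field_simps)
    qed (use s in \<open>auto simp: m_def\<close>)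
    then have "1 / (1 + 1 / m) ^ m \<le> R / (1 + R / m) ^ m"
      using h by (intro mean_bound_mono) (auto simp: m_def R_def)
    also have "\<dots> \<le> V n p" unfolding R_def by (rule V_ge_mean[OF n p_range m_def])
    finally show ?thesis
      unfolding m_def[symmetric] by (simp add: power_int_minus inverse_eq_divide)
  qed
  show "V n p > (1 + 1 / real (n - threshold n p)) powi (- int (n - threshold n p))"
    if "threshold n p < n \<and> odds_sum n p (threshold n p) > 1 + 1 / real (n - threshold n p)"
    unfolding power_int_minus power_int_of_nat inverse_eq_divide
    using that by (intro V_gt_large_odds[OF n p_range _ refl]) auto
next
  fix \<rho> :: real and p' assume \<rho>: "\<rho> \<in> {0..<1}" and p': "\<forall>j\<in>{1..n}. p' j = \<rho> / (real n + \<rho>)"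
  have p'01: "\<forall>j\<in>{1..n}. p' j \<in> {0..<1}" 
  proof -
    have "\<rho> / (real n + \<rho>) \<in> {0..<1}" using \<rho> n by simp
    then show ?thesis using p' by simp
  qed
  show R: "odds_sum n p' 1 = \<rho>" using odds_sum_const[OF p'] \<rho> n by simp
  show th: "threshold n p' = 1"
  proof (rule threshold_eqI)
    show "odds_sum n p' (Suc 1) < 1"
      using odds_sum_antimono[OF p'01, of "Suc 1"] R \<rho> by simp
  qed (use n p'01 in auto)
  show "V n p' = \<rho> * (1 + \<rho> / real n) powi (- int n)"
    using V_const[OF th p'] \<rho> n R by simp
next
  fix s p' assume s: "s \<in> {1..n}"
    and h: "(\<forall>j\<in>{1..n}. p' j \<in> {0..<1}) \<and> (\<forall>j\<in>{s..n}. p' j = 1 / real (n - s + 2))"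
  \<comment> \<open>With \<open>a = 1\<close> and \<open>b = n - s + 1\<close> the
    \<open>n - s + 1\<close> equal odds sum to exactly 1.\<close>
  have p': "\<forall>j\<in>{s..n}. p' j = 1 / (real (n - s + 1) + 1)" using h by (simp add: algebra_simps)
  have R: "odds_sum n p' s = 1" using odds_sum_const[OF p'] s by simp
  then show "1 \<le> odds_sum n p' s" by simp
  show "odds_sum n p' s \<le> 1 + 1 / real (n - s)" using R by simp
  \<comment> \<open>Since the sum from \<open>s\<close> is exactly 1, dropping a positive term
    pushes the next sum below 1.\<close>
  have "odds p' s > 0" using h s by (simp add: odds_def)
  then have "odds_sum n p' (Suc s) < 1" using R s by (simp add: odds_sum_Suc)
  then show th: "threshold n p' = s"
    using s h R by (intro threshold_eqI) auto
  show "V n p' = (1 + 1 / real (n - s + 1)) powi (- int (n - s + 1))"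
    using V_const[OF th p'] s R by simp
next
  fix s and \<epsilon> :: real assume s: "s \<in> {1..<n}" and \<epsilon>: "\<epsilon> > 0"
  define k where "k = n - s"
  have k: "k \<ge> 1" using s by (auto simp: k_def)
  let ?f = "\<lambda>\<alpha>. (1 + 1 / real k + (1 - \<alpha>)) / ((1 + 1 / k + (2 - 2 * \<alpha>)) * (1 + \<alpha> / k) ^ k)"
  from tendstoD[OF large_odds_family_limit[OF k] \<epsilon>] obtain b where
    b: "b < 1" "\<forall>\<alpha>>b. \<alpha> < 1 \<longrightarrow> dist (?f \<alpha>) (1 / (1 + 1 / k) ^ k) < \<epsilon>"
    unfolding eventually_at_left_field by blast
  show "\<exists>\<delta>\<in>{0<..<1}. \<forall>\<alpha>\<in>{\<delta><..<1}. \<forall>p'.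
       (\<forall>j\<in>{1..n}. j \<noteq> s \<longrightarrow> p' j \<in> {0..<1}) \<and>
       p' s = (1 + (2 - 2 * \<alpha>) * real (n - s)) / (1 + (3 - 2 * \<alpha>) * real (n - s)) \<and>
       (\<forall>j\<in>{s+1..n}. p' j = \<alpha> / (real (n - s) + \<alpha>))
       \<longrightarrow> p' s \<in> {0..<1} \<and> threshold n p' = s \<and> odds_sum n p' s > 1 + 1 / real (n - s) \<and>
           \<bar>V n p' - (1 + 1 / real (n - s)) powi (- int (n - s))\<bar> < \<epsilon>"
    unfolding k_def[symmetric]
  \<comment> \<open>The bound \<open>b\<close> from the limit may be negative; the maximum with
    \<open>1/2\<close> keeps the witness, and hence \<alpha>, positive.\<close>
  proof (intro bexI[of _ "max b (1/2)"] ballI allI impI)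
    fix \<alpha> p' assume \<alpha>: "\<alpha> \<in> {max b (1/2)<..<1}"
      and h: "(\<forall>j\<in>{1..n}. j \<noteq> s \<longrightarrow> p' j \<in> {0..<1}) \<and>
       p' s = (1 + (2 - 2 * \<alpha>) * real k) / (1 + (3 - 2 * \<alpha>) * real k) \<and>
       (\<forall>j\<in>{s+1..n}. p' j = \<alpha> / (real k + \<alpha>))"
    have \<alpha>': "0 < \<alpha>" "\<alpha> < 1" "b < \<alpha>" using \<alpha> by auto
    have ps: "p' s = (1 + (2 - 2 * \<alpha>) * real k) / (1 + (3 - 2 * \<alpha>) * real k)"
      and pj: "\<forall>j\<in>{Suc s..n}. p' j = \<alpha> / (real k + \<alpha>)" using h by auto
    note F = large_odds_family[OF s k_def \<alpha>'(1,2) ps pj]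
    have "\<bar>?f \<alpha> - 1 / (1 + 1 / k) ^ k\<bar> < \<epsilon>" using b \<alpha>' by (simp add: dist_real_def)
    then have "\<bar>V n p' - (1 + 1 / real k) powi (- int k)\<bar> < \<epsilon>"
      unfolding F(4) by (simp add: power_int_minus inverse_eq_divide)
    then show "p' s \<in> {0..<1} \<and> threshold n p' = s \<and> odds_sum n p' s > 1 + 1 / real k \<and>
           \<bar>V n p' - (1 + 1 / real k) powi (- int k)\<bar> < \<epsilon>"
      using F(1-3) \<alpha>' by simp
  qed (use b in auto)
qed

end
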